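(* For every integer $n\geq 4$ with $n\equiv 0$ or $1 \pmod 3$, there exists an equitably 2-chromatic $P_4$ system of order $n$.
   Context: $P_4=(a_1,a_2,a_3,a_4)$ denotes the path on four distinct vertices with edges $\{a_1,a_2\},\{a_2,a_3\},\{a_3,a_4\}$. A $P_4$ system of order $n>1$ is a pair $(V,\mathcal B)$ where $|V|=n$ and $\mathcal B$ is a set of $P_4$ paths with vertices in $V$ whose edge sets partition the edge set of the complete graph on $V$. A $k$-colouring of $(V,\mathcal B)$ is a partition of $V$ into $k$ (possibly empty) colour classes such that no path in $\mathcal B$ is monochromatic. The system is $k$-colourable if it has a $k$-colouring, and $k$-chromatic if it is $k$-colourable but not $(k-1)$-colourable. A colouring is equitable if the cardinalities of the colour classes differ by at most one. The system is equitably $k$-chromatic if it is $k$-chromatic and admits an equitable $k$-colouring. *)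

theory Defs
  imports Main "HOL-Library.Disjoint_Sets" "HOL-Library.Ramsey"
begin

text \<open>A path is represented by its edge set, so that \<open>(a, b, c, d)\<close> and its reversal
  \<open>(d, c, b, a)\<close> are the same path; its vertex set is then the union of its edges.\<close>

definition P4 :: "'a \<Rightarrow> 'a \<Rightarrow> 'a \<Rightarrow> 'a \<Rightarrow> 'a set set" where
  "P4 a\<^sub>1 a\<^sub>2 a\<^sub>3 a\<^sub>4 = {{a\<^sub>1, a\<^sub>2}, {a\<^sub>2, a\<^sub>3}, {a\<^sub>3, a\<^sub>4}}"

definition P4_paths :: "'a set \<Rightarrow> 'a set set set" where
  "P4_paths V =
    {P4 a\<^sub>1 a\<^sub>2 a\<^sub>3 a\<^sub>4 | a\<^sub>1 a\<^sub>2 a\<^sub>3 a\<^sub>4. {a\<^sub>1, a\<^sub>2, a\<^sub>3, a\<^sub>4} \<subseteq> V \<and> distinct [a\<^sub>1, a\<^sub>2, a\<^sub>3, a\<^sub>4]}"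

abbreviation path_verts :: "'a set set \<Rightarrow> 'a set" where
  "path_verts p \<equiv> \<Union> p"

text \<open>\<^term>\<open>nsets V 2\<close> is the edge set of the complete graph on \<open>V\<close>.
  Finiteness of \<open>V\<close> follows from \<open>card V = n\<close> and \<open>n > 1\<close>.\<close>

definition P4_system :: "nat \<Rightarrow> 'a set \<Rightarrow> 'a set set set \<Rightarrow> bool" where
  "P4_system n V \<B> \<longleftrightarrow>
    n > 1 \<and> card V = n \<and> \<B> \<subseteq> P4_paths V \<and> partition_on (nsets V 2) \<B>"

text \<open>The colour classes are the sets \<open>C i\<close> with \<open>i < k\<close>. They are an indexed family, since
  several of them may be empty.\<close>

definition colouring :: "nat \<Rightarrow> 'a set \<Rightarrow> 'a set set set \<Rightarrow> (nat \<Rightarrow> 'a set) \<Rightarrow> bool" where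
  "colouring k V \<B> C \<longleftrightarrow>
    (\<Union>i<k. C i) = V \<and> disjoint_family_on C {..<k} \<and>
    (\<forall>p\<in>\<B>. \<not> (\<exists>i<k. path_verts p \<subseteq> C i))"

definition colourable :: "nat \<Rightarrow> 'a set \<Rightarrow> 'a set set set \<Rightarrow> bool" where
  "colourable k V \<B> \<longleftrightarrow> (\<exists>C. colouring k V \<B> C)"

definition chromatic :: "nat \<Rightarrow> 'a set \<Rightarrow> 'a set set set \<Rightarrow> bool" where
  "chromatic k V \<B> \<longleftrightarrow> colourable k V \<B> \<and> \<not> colourable (k - 1) V \<B>"

definition equitable :: "nat \<Rightarrow> (nat \<Rightarrow> 'a set) \<Rightarrow> bool" where
  "equitable k C \<longleftrightarrow> (\<forall>i<k. \<forall>j<k. card (C i) \<le> card (C j) + 1)"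

definition equitably_chromatic :: "nat \<Rightarrow> 'a set \<Rightarrow> 'a set set set \<Rightarrow> bool" where
  "equitably_chromatic k V \<B> \<longleftrightarrow>
    chromatic k V \<B> \<and> (\<exists>C. colouring k V \<B> C \<and> equitable k C)"

end

theory Submission
  imports Defs
begin

text \<open>On the vertices \<open>0, \<dots>, n - 1\<close> coloured by parity, go from \<open>n\<close> to \<open>n + 6\<close>. Up to one leftover
  vertex, which joins the six new ones, the old vertices come in pairs; the edges from a pair to
  a new triple form a \<open>K\<^sub>2\<^sub>,\<^sub>3\<close>, which splits into two paths, and the six new vertices
  split into two triples such that each of these paths sees both colours. There remains
  a \<open>K\<^sub>6\<close> or a \<open>K\<^sub>7\<close>, so only decompositions of \<open>K\<^sub>4\<close>, \<open>K\<^sub>6\<close>, \<open>K\<^sub>7\<close> and \<open>K\<^sub>9\<close> are needed.\<close>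

section \<open>Decompositions into paths with both colours\<close>

text \<open>Paths are added one at a time and no vertex set is carried along, so decompositions of
  edge-disjoint graphs combine by taking unions. The set of paths itself is recovered only once, at
  the end.\<close>

inductive P4_decomposable :: "('a \<Rightarrow> 'c) \<Rightarrow> 'a set set \<Rightarrow> bool" for col where
  empty: "P4_decomposable col {}"
| add_path: "P4_decomposable col (P4 a b c d \<union> E)"
    if "P4_decomposable col E" "distinct [a, b, c, d]" "\<not> (col a = col b \<and> col b = col c \<and> col c = col d)"
       "disjnt (P4 a b c d) E"

lemma P4_decomposable_Un:
  assumes "P4_decomposable col E" "P4_decomposable col F" "disjnt E F"
  shows "P4_decomposable col (E \<union> F)"
  using assms
proof induction
  case (add_path E a b c d)
  then have "P4_decomposable col (P4 a b c d \<union> (E \<union> F))"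
    by (intro P4_decomposable.add_path) (auto simp: disjnt_def)
  then show ?case
    by (simp add: Un_assoc)
qed simp

lemma P4_decomposable_path:
  assumes "distinct [a, b, c, d]" "\<not> (col a = col b \<and> col b = col c \<and> col c = col d)"
  shows "P4_decomposable col (P4 a b c d)"
  using P4_decomposable.add_path[OF P4_decomposable.empty assms] by simp

text \<open>Relabelling pulls the colouring back along \<open>f\<close>, so each path shows the same
  colours before and after. Injectivity of \<open>f\<close> passes to the map on edges and keeps
  edge-disjoint pieces disjoint.\<close>

lemma P4_decomposable_image:
  assumes "P4_decomposable (col \<circ> f) E" "inj f"
  shows "P4_decomposable col ((`) f ` E)"
  using assms(1)
proof induction
  case (add_path E a b c d)
  have "(`) f ` (P4 a b c d \<union> E) = P4 (f a) (f b) (f c) (f d) \<union> (`) f ` E"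
    by (simp add: P4_def image_Un)
  moreover have "inj ((`) f)"
    using assms(2) by (intro injI) (simp add: inj_image_eq_iff)
  then have "disjnt ((`) f ` P4 a b c d) ((`) f ` E)"
    using add_path.hyps by (simp add: disjnt_def flip: image_Int)
  then have "disjnt (P4 (f a) (f b) (f c) (f d)) ((`) f ` E)"
    by (simp add: P4_def)
  ultimately show ?case
    using add_path assms(2) by (auto simp: inj_eq intro!: P4_decomposable.add_path)
qed (simp add: P4_decomposable.empty)

lemma P4_pathsI:
  assumes "distinct [a, b, c, d]" "{a, b, c, d} \<subseteq> V"
  shows "P4 a b c d \<in> P4_paths V"
  unfolding P4_paths_def mem_Collect_eq
  by (intro exI[of _ a] exI[of _ b] exI[of _ c] exI[of _ d] conjI refl assms)

lemma P4_paths_mono: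
  assumes "A \<subseteq> B"
  shows "P4_paths A \<subseteq> P4_paths B"
proof
  fix p assume "p \<in> P4_paths A"
  then obtain a b c d where "p = P4 a b c d" "{a, b, c, d} \<subseteq> A" "distinct [a, b, c, d]"
    by (auto simp: P4_paths_def)
  with assms show "p \<in> P4_paths B"
    by (auto intro!: P4_pathsI)
qed

text \<open>Each added path is nonempty and disjoint from what is already covered, hence a new block
  of the partition. Being mixed is restated through two vertices of different colours, the form that
  later refutes containment in a colour class.\<close>

lemma P4_decomposable_partition:
  assumes "P4_decomposable col E"
  obtains \<B> where "partition_on E \<B>" "\<B> \<subseteq> P4_paths (\<Union>E)"
    "\<forall>p\<in>\<B>. \<exists>x\<in>\<Union>p. \<exists>y\<in>\<Union>p. col x \<noteq> col y"
proof -
  have "\<exists>\<B>. partition_on E \<B> \<and> \<B> \<subseteq> P4_paths (\<Union>E) \<and>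
          (\<forall>p\<in>\<B>. \<exists>x\<in>\<Union>p. \<exists>y\<in>\<Union>p. col x \<noteq> col y)"
    using assms
  proof induction
    case empty
    show ?case
      by (intro exI[of _ "{}"]) (simp add: partition_on_empty)
  next
    case (add_path E a b c d)
    let ?P = "P4 a b c d"
    obtain \<B> where \<B>: "partition_on E \<B>" "\<B> \<subseteq> P4_paths (\<Union>E)"
      "\<forall>p\<in>\<B>. \<exists>x\<in>\<Union>p. \<exists>y\<in>\<Union>p. col x \<noteq> col y"
      using add_path.IH by blast
    have "?P \<union> E - ?P = E"
      using add_path.hyps by (auto simp: disjnt_def)
    moreover have "disjnt ?P (\<Union>\<B>)"
      using add_path.hyps partition_onD1[OF \<B>(1)] by simp
    moreover have "?P \<noteq> {}"
      by (simp add: P4_def)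
    ultimately have "partition_on (?P \<union> E) (insert ?P \<B>)"
      using \<B>(1) by (simp add: partition_on_insert)
    moreover have "?P \<in> P4_paths (\<Union>(?P \<union> E))"
      using add_path.hyps(2) by (intro P4_pathsI) (simp_all add: P4_def)
    moreover have "P4_paths (\<Union>E) \<subseteq> P4_paths (\<Union>(?P \<union> E))"
      by (intro P4_paths_mono) simp
    moreover have "\<exists>x\<in>\<Union>?P. \<exists>y\<in>\<Union>?P. col x \<noteq> col y"
      using add_path.hyps(3) by (auto simp: P4_def)
    ultimately show ?case
      using \<B>(2,3) by (intro exI[of _ "insert ?P \<B>"] conjI) auto
  qed
  then show thesis
    by (elim exE conjE) (rule that)
qed

section \<open>Small complete graphs by computation\<close>

text \<open>Sorting the endpoints turns equality of edges into equality of pairs of numbers, so that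
  the check of a decomposition can be evaluated.\<close>

definition ordered_edges :: "(nat \<times> nat \<times> nat \<times> nat) list \<Rightarrow> (nat \<times> nat) list" where
  "ordered_edges ps =
     concat (map (\<lambda>(a, b, c, d). [(min a b, max a b), (min b c, max b c), (min c d, max c d)]) ps)"

text \<open>Distinctness says that no edge is used twice; the last conjunct lists all pairs
  \<open>(i, j)\<close> with \<open>i < j < n\<close>, so every edge of the complete graph is
  used.\<close>

definition mixed_decomposition :: "nat \<Rightarrow> (nat \<times> nat \<times> nat \<times> nat) list \<Rightarrow> bool" where
  "mixed_decomposition n ps \<longleftrightarrow>
     list_all (\<lambda>(a, b, c, d). distinct [a, b, c, d] \<and>
       \<not> (even a = even b \<and> even b = even c \<and> even c = even d)) ps \<and>
     distinct (ordered_edges ps) \<and>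
     set (ordered_edges ps) = set (concat (map (\<lambda>j. map (\<lambda>i. (i, j)) [0..<j]) [0..<n]))"

lemma ordered_edges_le: "(i, j) \<in> set (ordered_edges ps) \<Longrightarrow> i \<le> j"
  by (auto simp: ordered_edges_def)

lemma P4_decomposable_ordered_edges:
  assumes "list_all (\<lambda>(a, b, c, d). distinct [a, b, c, d] \<and>
       \<not> (even a = even b \<and> even b = even c \<and> even c = even d)) ps"
    and "distinct (ordered_edges ps)"
  shows "P4_decomposable even ((\<lambda>(i, j). {i, j}) ` set (ordered_edges ps))"
  using assms
proof (induction ps)
  case Nil
  show ?case
    by (simp add: ordered_edges_def P4_decomposable.empty)
next
  case (Cons p ps)
  obtain a b c d where p: "p = (a, b, c, d)"
    using prod_cases4 by blast
  let ?e = "\<lambda>(i :: nat, j). {i, j}"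
  let ?new = "{(min a b, max a b), (min b c, max b c), (min c d, max c d)}"
  have split: "ordered_edges (p # ps) =
      [(min a b, max a b), (min b c, max b c), (min c d, max c d)] @ ordered_edges ps"
    by (simp add: ordered_edges_def p)
  then have set_eq: "set (ordered_edges (p # ps)) = ?new \<union> set (ordered_edges ps)"
    by simp
  have new: "?e ` ?new = P4 a b c d"
  proof -
    have "{min x y, max x y} = {x, y}" for x y :: nat
      by (auto simp: min_def max_def)
    then show ?thesis
      by (simp add: P4_def)
  qed
  have "distinct ([(min a b, max a b), (min b c, max b c), (min c d, max c d)] @ ordered_edges ps)"
    using Cons.prems(2) by (simp only: split)
  then have dist: "distinct (ordered_edges ps)" "?new \<inter> set (ordered_edges ps) = {}"
    unfolding distinct_append by simp_all
  \<comment> \<open>On pairs with \<open>i \<le> j\<close> forgetting the order loses nothing, so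
    disjointness of the lists of pairs becomes disjointness of the sets of edges.\<close>
  have "inj_on ?e (set (ordered_edges (p # ps)))"
    by (intro inj_onI) (auto simp: doubleton_eq_iff dest!: ordered_edges_le)
  then have "?e ` (?new \<inter> set (ordered_edges ps)) = ?e ` ?new \<inter> ?e ` set (ordered_edges ps)"
    unfolding set_eq by (rule inj_on_image_Int) blast+
  then have "?e ` ?new \<inter> ?e ` set (ordered_edges ps) = {}"
    by (simp only: dist(2) image_empty)
  then have "P4_decomposable even (P4 a b c d \<union> ?e ` set (ordered_edges ps))"
    using Cons dist(1) unfolding new
    by (intro P4_decomposable.add_path) (auto simp: p disjnt_def)
  then show ?case
    unfolding set_eq image_Un new .
qed

lemma mixed_decomposition_decomposable:
  assumes "mixed_decomposition n ps"
  shows "P4_decomposable even (nsets {..<n} 2)"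
proof -
  have "set (ordered_edges ps) = {(i, j). i < j \<and> j < n}"
    using assms unfolding mixed_decomposition_def by auto
  moreover have "nsets {..<n} 2 \<subseteq> (\<lambda>(i, j). {i, j}) ` {(i, j). i < j \<and> j < n}"
    by (auto simp: ordered_nsets_2_eq)
  moreover have "(\<lambda>(i, j). {i, j}) ` {(i, j). i < j \<and> j < n} \<subseteq> nsets {..<n} 2"
    by auto
  ultimately have eq: "nsets {..<n} 2 = (\<lambda>(i, j). {i, j}) ` set (ordered_edges ps)"
    by (simp only: subset_antisym)
  show ?thesis
    using assms unfolding eq mixed_decomposition_def by (elim conjE) (rule P4_decomposable_ordered_edges)
qed

text \<open>The orders 4, 6, 7 and 9 are the admissible ones within one period of the step by six.
  Their 6, 15, 21 and 36 edges need 2, 5, 7 and 12 paths. Orders 6 and 7 serve again inside the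
  step.\<close>

lemma decomposable_K4: "P4_decomposable even (nsets {..<4 :: nat} 2)"
proof (rule mixed_decomposition_decomposable)
  show "mixed_decomposition 4 [(0, 1, 2, 3), (1, 3, 0, 2)]"
    by code_simp
qed

lemma decomposable_K6: "P4_decomposable even (nsets {..<6 :: nat} 2)"
proof (rule mixed_decomposition_decomposable)
  show "mixed_decomposition 6 [(0, 1, 2, 3), (0, 2, 4, 1), (0, 3, 1, 5), (0, 4, 5, 2), (0, 5, 3, 4)]"
    by code_simp
qed

lemma decomposable_K7: "P4_decomposable even (nsets {..<7 :: nat} 2)"
proof (rule mixed_decomposition_decomposable)
  show "mixed_decomposition 7 [(0, 1, 2, 3), (0, 2, 4, 1), (0, 3, 1, 5), (0, 4, 3, 5), (0, 5, 6, 1),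
    (0, 6, 2, 5), (3, 6, 4, 5)]"
    by code_simp
qed

lemma decomposable_K9: "P4_decomposable even (nsets {..<9 :: nat} 2)"
proof (rule mixed_decomposition_decomposable)
  show "mixed_decomposition 9 [(0, 1, 2, 3), (0, 2, 4, 1), (0, 3, 1, 5), (0, 4, 3, 5), (0, 5, 2, 6),
    (0, 6, 4, 5), (0, 7, 1, 6), (0, 8, 3, 6), (1, 8, 5, 6), (2, 7, 4, 8), (2, 8, 7, 3), (5, 7, 6, 8)]"
    by code_simp
qed

section \<open>Translates and complete bipartite pieces\<close>

lemma nsets_image:
  assumes "inj f"
  shows "nsets (f ` A) k = (`) f ` nsets A k"
proof
  show "nsets (f ` A) k \<subseteq> (`) f ` nsets A k"
  proof
    fix N assume N: "N \<in> nsets (f ` A) k"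
    then obtain M where M: "M \<subseteq> A" "N = f ` M"
      by (auto simp: nsets_def subset_image_iff)
    moreover have inj: "inj_on f M"
      using assms by (rule inj_on_subset) simp
    ultimately have "M \<in> nsets A k"
      using N by (simp add: nsets_def card_image finite_image_iff)
    with M show "N \<in> (`) f ` nsets A k"
      by blast
  qed
  show "(`) f ` nsets A k \<subseteq> nsets (f ` A) k"
  proof
    fix N assume "N \<in> (`) f ` nsets A k"
    then obtain M where "M \<subseteq> A" "finite M" "card M = k" "N = f ` M"
      by (auto simp: nsets_def)
    moreover have "card (f ` M) = card M"
      using inj_on_subset[OF assms subset_UNIV] by (rule card_image)
    ultimately show "N \<in> nsets (f ` A) k"
      by (simp add: nsets_def image_mono)
  qed
qed

text \<open>Translation by an even number preserves parity, hence the colouring.\<close>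

lemma decomposable_shift:
  assumes "P4_decomposable even (nsets {..<r :: nat} 2)"
  shows "P4_decomposable even (nsets {2 * m..<2 * m + r} 2)"
proof -
  have "even \<circ> (+) (2 * m) = (even :: nat \<Rightarrow> bool)"
    by (simp add: fun_eq_iff)
  then have "P4_decomposable even ((`) ((+) (2 * m)) ` nsets {..<r} 2)"
    using assms by (intro P4_decomposable_image) simp_all
  moreover have "nsets {2 * m..<2 * m + r} 2 = (`) ((+) (2 * m)) ` nsets {..<r} 2"
  proof -
    have "{2 * m..<2 * m + r} = (+) (2 * m) ` {..<r}"
      by (simp add: lessThan_atLeast0 add.commute)
    then show ?thesis
      by (simp add: nsets_image)
  qed
  ultimately show ?thesis
    by simp
qed

text \<open>For disjoint \<open>A\<close> and \<open>B\<close> this is the edge set of the complete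
  bipartite graph between them.\<close>

definition cross_edges :: "'a set \<Rightarrow> 'a set \<Rightarrow> 'a set set" where
  "cross_edges A B = (\<Union>x\<in>A. (\<lambda>y. {x, y}) ` B)"

lemma cross_edgesI: "x \<in> A \<Longrightarrow> y \<in> B \<Longrightarrow> {x, y} \<in> cross_edges A B"
  by (auto simp: cross_edges_def)

text \<open>The first assumption keeps left ends and right ends apart, so a common edge would have
  the same left end and the same right end in both families; the second assumption excludes one of
  these.\<close>

lemma disjnt_cross_edges:
  assumes "(A \<union> A') \<inter> (B \<union> B') = {}" "A \<inter> A' = {} \<or> B \<inter> B' = {}"
  shows "disjnt (cross_edges A B) (cross_edges A' B')"
proof -
  have False if "e \<in> cross_edges A B" "e \<in> cross_edges A' B'" for e
  proof -
    obtain x y x' y' where "e = {x, y}" "e = {x', y'}" "x \<in> A" "y \<in> B" "x' \<in> A'" "y' \<in> B'"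
      using \<open>e \<in> cross_edges A B\<close> \<open>e \<in> cross_edges A' B'\<close> unfolding cross_edges_def by blast
    moreover from this(1,2) have "x = x' \<and> y = y' \<or> x = y' \<and> y = x'"
      by (metis doubleton_eq_iff)
    ultimately show False
      using assms by blast
  qed
  then show ?thesis
    by (auto simp: disjnt_iff)
qed

text \<open>The paths \<open>a, u, b, v\<close> and \<open>u, c, v, a\<close> contain
  \<open>a\<close> together with \<open>b\<close> and with \<open>c\<close> respectively, so both
  are mixed whatever the colours of \<open>u\<close> and \<open>v\<close>.\<close>

lemma decomposable_K23:
  assumes "distinct [a, b, c, u, v]" "col a \<noteq> col b" "col a \<noteq> col c"
  shows "P4_decomposable col (cross_edges {u, v} {a, b, c})"
proof -
  have flip: "{a, u} = {u, a}" "{b, v} = {v, b}" "{c, v} = {v, c}"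
    by auto
  have "cross_edges {u, v} {a, b, c} = P4 a u b v \<union> P4 u c v a"
  proof -
    \<comment> \<open>The stars at \<open>u\<close> and \<open>v\<close> become the two paths by
      exchanging the edges \<open>{u, c}\<close> and \<open>{v, b}\<close>.\<close>
    have regroup: "{p, q, r} \<union> {p', q', r'} = {p, q, q'} \<union> {r, r', p'}" for p q r p' q' r' :: "'a set"
      by blast
    have "cross_edges {u, v} {a, b, c} = {{u, a}, {u, b}, {u, c}} \<union> {{v, a}, {v, b}, {v, c}}"
      by (simp add: cross_edges_def)
    also have "\<dots> = P4 a u b v \<union> P4 u c v a"
      unfolding P4_def flip by (rule regroup)
    finally show ?thesis .
  qed
  moreover have "disjnt (P4 a u b v) (P4 u c v a)"
    using assms(1) by (auto simp: disjnt_def P4_def doubleton_eq_iff)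
  ultimately show ?thesis
    using assms by (auto intro!: P4_decomposable_Un P4_decomposable_path)
qed

lemma decomposable_cross_edges:
  fixes m t :: nat
  assumes "2 * m \<le> t"
  shows "P4_decomposable even (cross_edges {..<2 * m} {t..<t + 6})"
  using assms
proof (induction m)
  case 0
  then show ?case
    by (simp add: cross_edges_def P4_decomposable.empty)
next
  case (Suc m)
  let ?u = "2 * m" and ?v = "2 * m + 1"
  \<comment> \<open>In each triple the first vertex has the parity opposite to the other two, as
    \<open>decomposable_K23\<close> requires. This holds for either parity of
    \<open>t\<close>.\<close>
  let ?A = "cross_edges {?u, ?v} {t, t + 1, t + 3}"
  let ?B = "cross_edges {?u, ?v} {t + 5, t + 2, t + 4}"
  have "P4_decomposable even ?A" "P4_decomposable even ?B"
    using Suc.prems by (auto intro!: decomposable_K23)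
  moreover have "disjnt ?A ?B"
    using Suc.prems by (intro disjnt_cross_edges) auto
  ultimately have "P4_decomposable even (?A \<union> ?B)"
    by (rule P4_decomposable_Un)
  moreover have "disjnt (cross_edges {..<2 * m} {t..<t + 6}) ?A"
    "disjnt (cross_edges {..<2 * m} {t..<t + 6}) ?B"
    using Suc.prems by (intro disjnt_cross_edges; auto)+
  then have "disjnt (cross_edges {..<2 * m} {t..<t + 6}) (?A \<union> ?B)"
    unfolding disjnt_def by blast
  ultimately have "P4_decomposable even (cross_edges {..<2 * m} {t..<t + 6} \<union> (?A \<union> ?B))"
    using Suc by (intro P4_decomposable_Un[of _ _ "?A \<union> ?B"]) simp_all
  moreover have "cross_edges {..<2 * Suc m} {t..<t + 6} =
      cross_edges {..<2 * m} {t..<t + 6} \<union> (?A \<union> ?B)"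
  proof -
    have "{..<2 * Suc m} = {..<2 * m} \<union> {?u, ?v}"
      by auto
    moreover have "{t..<t + 6} = {t, t + 1, t + 3} \<union> {t + 5, t + 2, t + 4}"
      by auto
    moreover have "cross_edges (X \<union> Y) Z = cross_edges X Z \<union> cross_edges Y Z"
      "cross_edges Z (X \<union> Y) = cross_edges Z X \<union> cross_edges Z Y" for X Y Z :: "nat set"
      by (simp_all add: cross_edges_def image_Un UN_Un UN_Un_distrib)
    ultimately show ?thesis
      by (simp only: Un_ac)
  qed
  ultimately show ?case
    by simp
qed

section \<open>Induction on the order\<close>

lemma decomposable_step:
  fixes n :: nat
  assumes "P4_decomposable even (nsets {..<n} 2)"
  shows "P4_decomposable even (nsets {..<n + 6} 2)"
proof -
  define m where "m = n div 2"
  have n: "n = 2 * m \<or> n = 2 * m + 1"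
    by (auto simp: m_def)
  \<comment> \<open>The block starts at the even number \<open>2 * m\<close>, so it is a
    parity-preserving translate: of the complete graph on 6 vertices if \<open>n\<close> is even,
    and on 7 if \<open>n\<close> is odd.\<close>
  let ?K = "nsets {2 * m..<n + 6} 2" and ?X = "cross_edges {..<2 * m} {n..<n + 6}"
  have K: "P4_decomposable even ?K"
    using n decomposable_shift[OF decomposable_K6, of m] decomposable_shift[OF decomposable_K7, of m]
    by (auto simp: numeral_eq_Suc)
  have X: "P4_decomposable even ?X"
    using n by (intro decomposable_cross_edges) auto
  have "disjnt ?K ?X"
    using n by (auto simp: disjnt_def cross_edges_def)
  then have KX: "P4_decomposable even (?K \<union> ?X)"
    using K X by (rule P4_decomposable_Un[rotated 2])
  \<comment> \<open>The old vertices meet the block of \<open>?K\<close> in at most the leftover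
    vertex \<open>2 * m\<close>, which is too few for a common edge; every edge of \<open>?X\<close>
    has a new endpoint.\<close>
  have "disjnt (nsets {..<n} 2) (?K \<union> ?X)"
    using n by (auto simp: disjnt_def cross_edges_def nsets_2_eq doubleton_eq_iff)
  then have "P4_decomposable even (nsets {..<n} 2 \<union> (?K \<union> ?X))"
    by (rule P4_decomposable_Un[OF assms KX])
  moreover have "nsets {..<n + 6} 2 = nsets {..<n} 2 \<union> (?K \<union> ?X)" (is "?L = ?R")
  proof
    show "?R \<subseteq> ?L"
      using n by (auto simp: cross_edges_def nsets_def)
    show "?L \<subseteq> ?R"
    proof
      fix e assume "e \<in> ?L"
      then obtain x y where e: "e = {x, y}" "x < y" "y < n + 6"
        by (auto simp: ordered_nsets_2_eq)
      \<comment> \<open>The cases are an edge between old vertices, an edge of \<open>?K\<close>,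
        and an edge of \<open>?X\<close>.\<close>
      then consider "y < n" | "2 * m \<le> x" | "x < 2 * m" "n \<le> y"
        by linarith
      then show "e \<in> ?R"
        using e by cases (auto intro: cross_edgesI)
    qed
  qed
  ultimately show ?thesis
    by simp
qed

lemma decomposable_complete:
  fixes n :: nat
  assumes "n \<ge> 4" "n mod 3 = 0 \<or> n mod 3 = 1"
  shows "P4_decomposable even (nsets {..<n} 2)"
  using assms
proof (induction n rule: less_induct)
  case (less n)
  show ?case
  proof (cases "n < 10")
    case True
    then have "n = 4 \<or> n = 6 \<or> n = 7 \<or> n = 9"
      using less.prems by presburger
    then show ?thesis
      by (elim disjE) (simp_all only: decomposable_K4 decomposable_K6 decomposable_K7 decomposable_K9)
  next
    case False
    \<comment> \<open>From 10 on, subtracting 6 stays at 4 or above and keeps the residue modulo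
      3.\<close>
    then obtain k where k: "n = k + 6" "k \<ge> 4"
      by (intro that[of "n - 6"]) simp_all
    moreover have "(k + 6) mod 3 = k mod 3"
      by presburger
    ultimately show ?thesis
      using decomposable_step[OF less.IH[of k]] less.prems(2) by simp
  qed
qed

section \<open>Sizes of the colour classes and the conclusion\<close>

lemma card_even_lessThan: "card {x. x < n \<and> even x} = (n + 1) div 2"
  and card_odd_lessThan: "card {x. x < n \<and> odd x} = n div 2" for n :: nat
proof (induction n)
  case (Suc n)
  have "{x. x < Suc n \<and> Q x} = (if Q n then insert n {x. x < n \<and> Q x} else {x. x < n \<and> Q x})"
    for Q :: "nat \<Rightarrow> bool"
    by (auto simp: less_Suc_eq)
  then show "card {x. x < Suc n \<and> even x} = (Suc n + 1) div 2"
    "card {x. x < Suc n \<and> odd x} = Suc n div 2"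
    using Suc by auto
qed auto

theorem theorem3p7:
  fixes n :: nat
  assumes "n \<ge> 4" and "n mod 3 = 0 \<or> n mod 3 = 1"
  shows "\<exists>(V :: nat set) \<B>. P4_system n V \<B> \<and> equitably_chromatic 2 V \<B>"
proof -
  let ?V = "{..<n}"
  obtain \<B> where part: "partition_on (nsets ?V 2) \<B>"
    and paths: "\<B> \<subseteq> P4_paths (\<Union>(nsets ?V 2))"
    and mixed: "\<forall>p\<in>\<B>. \<exists>x\<in>\<Union>p. \<exists>y\<in>\<Union>p. even x \<noteq> even y"
    by (rule P4_decomposable_partition[OF decomposable_complete[OF assms]])
  have "\<Union>(nsets ?V 2) \<subseteq> ?V"
    by (auto simp: nsets_def)
  then have "\<B> \<subseteq> P4_paths ?V"
    by (rule subset_trans[OF paths P4_paths_mono])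
  then have system: "P4_system n ?V \<B>"
    using part assms(1) by (simp add: P4_system_def)
  \<comment> \<open>Class 0 holds the even vertices. Every other index gives the odd ones, but only
    index 1 matters for two colours.\<close>
  define C where "C i = {x. x < n \<and> (if i = 0 then even x else odd x)}" for i :: nat
  have lt2: "i < 2 \<longleftrightarrow> i = 0 \<or> i = 1" for i :: nat
    by auto
  have "colouring 2 ?V \<B> C"
    unfolding colouring_def
  proof (intro conjI ballI notI)
    have "{..<2} = {0, 1 :: nat}"
      by auto
    then show "(\<Union>i<2. C i) = ?V"
      by (auto simp: C_def)
    show "disjoint_family_on C {..<2}"
      by (auto simp: disjoint_family_on_def C_def lt2)
    fix p assume "p \<in> \<B>" "\<exists>i<2. path_verts p \<subseteq> C i"
    then obtain i where "path_verts p \<subseteq> C i"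
      by (elim exE conjE)
    moreover obtain x y where "x \<in> \<Union>p" "y \<in> \<Union>p" "even x \<noteq> even y"
      using bspec[OF mixed \<open>p \<in> \<B>\<close>] by (elim bexE)
    ultimately have "x \<in> C i" "y \<in> C i"
      by blast+
    with \<open>even x \<noteq> even y\<close> show False
      by (simp add: C_def split: if_splits)
  qed
  moreover have "equitable 2 C"
    by (auto simp: equitable_def lt2 C_def card_even_lessThan card_odd_lessThan)
  moreover have "\<not> colourable (2 - 1) ?V \<B>"
  proof
    assume "colourable (2 - 1) ?V \<B>"
    then obtain D where D: "colouring 1 ?V \<B> D"
      by (auto simp: colourable_def)
    \<comment> \<open>A single class would be all of \<open>?V\<close> and contain every path, so
      one existing path is a contradiction; the path covering the edge \<open>{0, 1}\<close>
      provides it.\<close>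
    have "{0, 1} \<in> nsets ?V 2"
      using assms(1) by simp
    then obtain p where "p \<in> \<B>"
      using partition_onD1[OF part] by blast
    then have "\<Union>p \<subseteq> ?V"
      using partition_onD1[OF part] by (auto simp: nsets_def)
    moreover have "D 0 = ?V" and no_mono: "\<forall>p\<in>\<B>. \<not> \<Union>p \<subseteq> D 0"
      using D unfolding colouring_def by (elim conjE, simp add: lessThan_Suc)+
    ultimately show False
      using bspec[OF no_mono \<open>p \<in> \<B>\<close>] by simp
  qed
  ultimately have "equitably_chromatic 2 ?V \<B>"
    unfolding equitably_chromatic_def chromatic_def colourable_def by blast
  with system show ?thesis
    by blast
qed

end
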